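(* Consider a self-decomposable law on $\mathbb{R}$ with Lévy triplet $(\gamma,\sigma,\nu)$, whose Lévy density is $\nu(x)=k(x)/|x|$ with $k$ increasing on $(-\infty,0)$ and decreasing on $(0,+\infty)$. Then for every $0<a<1$ the law of its $a$-remainder has Lévy triplet $(\gamma_a,\sigma_a,\nu_a)$, where $$\gamma_a=\gamma(1-a)-a\int_{\mathbb{R}}\operatorname{sign}(x)\left(\mathbf{1}_{|x|\le \frac1a}-\mathbf{1}_{|x|\le 1}\right)k(x)\,dx,$$ $$\sigma_a=\sigma\sqrt{1-a^2},$$ $$\nu_a(x)=\frac{k(x)-k(x/a)}{|x|}=\nu(x)-\frac{\nu(x/a)}{a}.$$
   Context: A law on $\mathbb{R}$ with characteristic function $\eta(u)$ is self-decomposable if for every $0<a<1$ there is a law with characteristic function $\chi_a(u)$ such that $\eta(u)=\eta(au)\chi_a(u)$. The law with characteristic function $\chi_a$ (equivalently, a random variable with this law) is called the $a$-remainder of the given law; it is infinitely divisible. Self-decomposable laws are infinitely divisible with absolutely continuous Lévy measure, with density of the form $\nu(x)=k(x)/|x|$, where $k\ge 0$ is increasing on $(-\infty,0)$ and decreasing on $(0,+\infty)$ (in the non-strict sense). Lévy triplet convention: an infinitely divisible law has Lévy triplet $(\gamma,\sigma,\nu)$, with $\nu$ denoting the density of its Lévy measure, if the logarithm of its characteristic function is $$\psi(u)=iu\gamma-\tfrac12\sigma^2u^2+\int_{\mathbb{R}}\left(e^{iux}-1-iux\mathbf{1}_{|x|\le1}\right)\nu(x)\,dx,$$ where $\sigma\ge0$.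 *)

theory Defs
  imports "HOL-Probability.Probability"
begin

text \<open>
  A law on the real line is a measure \<open>M\<close> with \<open>real_distribution M\<close>;
  its characteristic function is the library's \<open>char M\<close>.
\<close>

definition infinitely_divisible :: "real measure \<Rightarrow> bool" where
  "infinitely_divisible M \<longleftrightarrow>
     real_distribution M \<and>
     (\<forall>n::nat. n \<ge> 1 \<longrightarrow>
        (\<exists>N. real_distribution N \<and> (\<forall>u. char M u = char N u ^ n)))"

definition remainder_law :: "real \<Rightarrow> real measure \<Rightarrow> real measure \<Rightarrow> bool" where
  "remainder_law a M R \<longleftrightarrow>
     real_distribution R \<and> (\<forall>u. char M u = char M (a * u) * char R u)"

definition self_decomposable :: "real measure \<Rightarrow> bool" where
  "self_decomposable M \<longleftrightarrow>
     real_distribution M \<and> (\<forall>a. 0 < a \<and> a < 1 \<longrightarrow> (\<exists>R. remainder_law a M R))"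

text \<open>
  The integrability condition is the one defining Levy measures. It makes the integral in
  \<open>levy_exponent\<close> converge; without it the library integral would silently be \<open>0\<close>.
  Densities matter only up to null sets, so their value at \<open>0\<close> is irrelevant.
\<close>

definition levy_density :: "(real \<Rightarrow> real) \<Rightarrow> bool" where
  "levy_density \<nu> \<longleftrightarrow>
     \<nu> \<in> borel_measurable borel \<and> (AE x in lborel. 0 \<le> \<nu> x) \<and>
     integrable lborel (\<lambda>x. min 1 (x\<^sup>2) * \<nu> x)"

definition levy_exponent :: "real \<Rightarrow> real \<Rightarrow> (real \<Rightarrow> real) \<Rightarrow> real \<Rightarrow> complex" where
  "levy_exponent \<gamma> \<sigma> \<nu> u =
     \<i> * of_real u * of_real \<gamma> - of_real (\<sigma>\<^sup>2 * u\<^sup>2 / 2)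
     + (\<integral>x. (exp (\<i> * of_real u * of_real x) - 1
             - \<i> * of_real u * of_real x * of_bool (\<bar>x\<bar> \<le> 1)) * of_real (\<nu> x) \<partial>lborel)"

text \<open>
  The logarithm of a characteristic function without zeros is the continuous one vanishing at
  \<open>0\<close>. The Levy exponent is continuous and vanishes at \<open>0\<close>, so it is this logarithm
  exactly when its exponential is the characteristic function.
\<close>

definition has_levy_triplet ::
    "real measure \<Rightarrow> real \<Rightarrow> real \<Rightarrow> (real \<Rightarrow> real) \<Rightarrow> bool" where
  "has_levy_triplet M \<gamma> \<sigma> \<nu> \<longleftrightarrow>
     infinitely_divisible M \<and> \<sigma> \<ge> 0 \<and> levy_density \<nu> \<and>
     (\<forall>u. char M u = exp (levy_exponent \<gamma> \<sigma> \<nu> u))"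

end

theory Submission
  imports Defs
begin

text \<open>
  Write \<open>\<psi>\<close> for the Levy exponent of the given law. A Levy exponent is the logarithm of a
  characteristic function that nowhere vanishes, so the equation defining the remainder can be
  solved for its characteristic function, which is \<open>exp (\<psi> u - \<psi> (a * u))\<close>. That
  \<open>\<psi> u - \<psi> (a * u)\<close> is the Levy exponent of the claimed triplet is a computation
  (\<open>levy_exponent_diff_scale\<close>). The linear and Gaussian terms give the factors \<open>1 - a\<close> and
  \<open>1 - a\<^sup>2\<close>. In the jump integral of \<open>\<psi> (a * u)\<close> the variable is rescaled by \<open>a\<close>, which turns the
  density \<open>\<nu> x\<close> into \<open>\<nu> (x / a) / a\<close>, but also moves the truncation point from \<open>1\<close> to \<open>a\<close>; restoring
  the truncation costs a linear term, the integral in the drift. The difference of the two densities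
  is again a Levy density because \<open>k\<close> decreases away from the origin
  (\<open>levy_density_remainder\<close>).

  Having a Levy triplet includes being infinitely divisible, so \<open>n\<close>-th roots of the remainder must be
  produced. They are laws with the exponent divided by \<open>n\<close>, which is again a Levy exponent; the bulk
  of the development therefore shows that the exponential of every Levy exponent is a characteristic
  function (\<open>characteristic_function_levy_exponent\<close>). It is a pointwise limit of
  products of Gaussian and compound Poisson characteristic functions, the latter being limits of
  powers \<open>(1 + r * (\<phi> u - 1) / n) ^ n\<close>. Both limits rest on the fact that a pointwise limit of
  characteristic functions which is continuous at \<open>0\<close> is a characteristic function
  (\<open>characteristic_function_limit\<close>); the tightness behind it comes from averaging against Gaussians.
\<close>

section \<open>Closure properties of characteristic functions\<close>

definition characteristic_function :: "(real \<Rightarrow> complex) \<Rightarrow> bool" where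
  "characteristic_function \<phi> \<longleftrightarrow> (\<exists>M. real_distribution M \<and> char M = \<phi>)"

lemma characteristic_functionI:
  assumes "real_distribution M" "\<And>u. char M u = \<phi> u"
  shows "characteristic_function \<phi>"
  using assms unfolding characteristic_function_def by (intro exI[of _ M]) auto

lemma characteristic_function_mult:
  assumes "characteristic_function \<phi>" "characteristic_function \<psi>"
  shows "characteristic_function (\<lambda>u. \<phi> u * \<psi> u)"
proof -
  obtain M N where M: "real_distribution M" "char M = \<phi>" and N: "real_distribution N" "char N = \<psi>"
    using assms by (auto simp: characteristic_function_def)
  interpret M: real_distribution M by fact
  interpret N: real_distribution N by fact
  interpret P: pair_prob_space M N ..
  let ?D = "distr (M \<Otimes>\<^sub>M N) borel (\<lambda>z. fst z + snd z)"
  have D: "real_distribution ?D"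
    by (intro P.real_distribution_distr) simp
  have int: "integrable (M \<Otimes>\<^sub>M N) (\<lambda>z. iexp (u * (fst z + snd z)))" for u
    by (rule P.integrable_const_bound[where B = 1]) (auto simp del: of_real_add of_real_mult)
  have "char ?D u = \<phi> u * \<psi> u" for u
  proof -
    have "char ?D u = (\<integral>z. iexp (u * (fst z + snd z)) \<partial>(M \<Otimes>\<^sub>M N))"
      by (simp add: char_def integral_distr)
    also have "\<dots> = (\<integral>x. (\<integral>y. iexp (u * x) * iexp (u * y) \<partial>N) \<partial>M)"
      by (subst P.integral_fst'[OF int, symmetric]) (simp add: algebra_simps exp_add)
    also have "\<dots> = char M u * char N u"
      by (simp add: char_def)
    finally show ?thesis by (simp add: M N)
  qed
  with D show ?thesis by (rule characteristic_functionI)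
qed

lemma characteristic_function_affine:
  assumes "characteristic_function \<phi>"
  shows "characteristic_function (\<lambda>u. iexp (u * b) * \<phi> (c * u))"
proof -
  obtain M where M: "real_distribution M" "char M = \<phi>"
    using assms by (auto simp: characteristic_function_def)
  interpret M: real_distribution M by fact
  have "real_distribution (distr M borel (\<lambda>x. b + c * x))"
    by (intro M.real_distribution_distr) simp
  moreover have "char (distr M borel (\<lambda>x. b + c * x)) u = iexp (u * b) * \<phi> (c * u)" for u
    by (simp add: M(2)[symmetric] char_def integral_distr exp_add ring_distribs mult_ac)
  ultimately show ?thesis by (rule characteristic_functionI)
qed

lemma characteristic_function_one: "characteristic_function (\<lambda>u. 1)"
proof -
  interpret N: real_distribution std_normal_distribution by (rule real_dist_normal_dist)
  have "characteristic_function (char std_normal_distribution)"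
    using real_dist_normal_dist by (rule characteristic_functionI) simp
  from characteristic_function_affine[OF this, of 0 0] show ?thesis
    by (simp add: N.char_zero)
qed

lemma characteristic_function_power:
  "characteristic_function \<phi> \<Longrightarrow> characteristic_function (\<lambda>u. \<phi> u ^ n)"
  by (induction n) (auto intro: characteristic_function_one characteristic_function_mult)

lemma characteristic_function_norm_le_1:
  "characteristic_function \<phi> \<Longrightarrow> norm (\<phi> u) \<le> 1"
  unfolding characteristic_function_def using real_distribution.cmod_char_le_1 by auto

lemma characteristic_function_isCont: "characteristic_function \<phi> \<Longrightarrow> isCont \<phi> u"
  unfolding characteristic_function_def using real_distribution.isCont_char by blast

lemma characteristic_function_gaussian:
  "characteristic_function (\<lambda>u. exp (\<i> * of_real u * of_real \<gamma> - of_real (\<sigma>\<^sup>2 * u\<^sup>2 / 2)))"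
proof -
  have "characteristic_function (char std_normal_distribution)"
    using real_dist_normal_dist by (rule characteristic_functionI) simp
  moreover have "iexp (u * \<gamma>) * char std_normal_distribution (\<sigma> * u)
      = exp (\<i> * of_real u * of_real \<gamma> - of_real (\<sigma>\<^sup>2 * u\<^sup>2 / 2))" for u
    by (simp add: char_std_normal_distribution exp_of_real[symmetric] exp_add[symmetric]
        power_mult_distrib mult_ac)
  ultimately show ?thesis
    using characteristic_function_affine[of "char std_normal_distribution" \<gamma> \<sigma>] by simp
qed

text \<open>
  If \<open>X\<close> has characteristic function \<open>\<phi>\<close> and \<open>B\<close> is an independent Bernoulli variable with
  parameter \<open>p\<close>, this is the characteristic function of \<open>B X\<close>. Powers of such functions
  approximate the compound Poisson laws.
\<close>
lemma characteristic_function_lazy: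
  assumes "characteristic_function \<phi>" "0 \<le> p" "p \<le> 1"
  shows "characteristic_function (\<lambda>u. 1 + of_real p * (\<phi> u - 1))"
proof -
  obtain M where M: "real_distribution M" "char M = \<phi>"
    using assms by (auto simp: characteristic_function_def)
  interpret M: real_distribution M by fact
  let ?B = "measure_pmf (bernoulli_pmf p)"
  interpret B: prob_space ?B by (rule prob_space_measure_pmf)
  interpret P: pair_prob_space ?B M ..
  let ?X = "\<lambda>z. if fst z then snd z else 0 :: real"
  have [measurable]: "?X \<in> borel_measurable (?B \<Otimes>\<^sub>M M)" by measurable
  have D: "real_distribution (distr (?B \<Otimes>\<^sub>M M) borel ?X)"
    by (intro P.real_distribution_distr) simp
  have int: "integrable (?B \<Otimes>\<^sub>M M) (\<lambda>z. iexp (u * ?X z))" for u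
    by (rule P.integrable_const_bound[where B = 1]) (auto simp del: of_real_mult)
  have "char (distr (?B \<Otimes>\<^sub>M M) borel ?X) u = 1 + of_real p * (\<phi> u - 1)" for u
  proof -
    have "char (distr (?B \<Otimes>\<^sub>M M) borel ?X) u = (\<integral>z. iexp (u * ?X z) \<partial>(?B \<Otimes>\<^sub>M M))"
      by (simp add: char_def integral_distr)
    also have "\<dots> = (\<integral>b. (\<integral>x. iexp (u * ?X (b, x)) \<partial>M) \<partial>?B)"
      by (subst P.integral_fst'[OF int, symmetric]) simp
    also have "\<dots> = (\<integral>b. (if b then \<phi> u else 1) \<partial>?B)"
      by (intro Bochner_Integration.integral_cong) (auto simp: M(2)[symmetric] char_def M.prob_space[simplified])
    also have "\<dots> = 1 + of_real p * (\<phi> u - 1)"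
      using assms by (subst integral_measure_pmf[of UNIV]) (auto simp: UNIV_bool scaleR_conv_of_real algebra_simps)
    finally show ?thesis .
  qed
  with D show ?thesis by (rule characteristic_functionI)
qed

section \<open>Limits of characteristic functions\<close>

text \<open>
  Fubini's theorem applied to \<open>iexp (s * t * x)\<close>: the standard normal law is, up to a constant, its
  own Fourier transform. Averaging the characteristic function against it therefore measures how
  much mass \<open>M\<close> has near \<open>0\<close> at scale \<open>1 / s\<close>.
\<close>
lemma integral_char_std_normal:
  assumes "real_distribution M"
  shows "(\<integral>t. char M (s * t) \<partial>std_normal_distribution)
       = of_real (\<integral>x. exp (- (s * x)\<^sup>2 / 2) \<partial>M)"
proof -
  interpret M: real_distribution M by fact
  interpret N: real_distribution std_normal_distribution by (rule real_dist_normal_dist)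
  interpret P: pair_prob_space std_normal_distribution M ..
  have int: "integrable (std_normal_distribution \<Otimes>\<^sub>M M) (\<lambda>z. iexp (s * fst z * snd z))"
    by (rule P.integrable_const_bound[where B = 1]) (auto simp del: of_real_mult)
  have "(\<integral>t. char M (s * t) \<partial>std_normal_distribution)
      = (\<integral>t. (\<integral>x. iexp (s * t * x) \<partial>M) \<partial>std_normal_distribution)"
    by (simp add: char_def)
  also have "\<dots> = (\<integral>x. (\<integral>t. iexp (s * t * x) \<partial>std_normal_distribution) \<partial>M)"
    using P.Fubini_integral[of "\<lambda>t x. iexp (s * t * x)"] int by (simp add: split_beta')
  also have "\<dots> = (\<integral>x. char std_normal_distribution (s * x) \<partial>M)"
    by (simp add: char_def mult_ac)
  also have "\<dots> = (\<integral>x. complex_of_real (exp (- (s * x)\<^sup>2 / 2)) \<partial>M)"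
    by (simp only: char_std_normal_distribution)
  finally show ?thesis by (simp only: integral_complex_of_real)
qed

text \<open>
  Outside the interval \<open>\<bar>s * x\<bar> < 1\<close> the Gaussian weight is at most \<open>exp (- 1 / 2) \<le> 2 / 3\<close>, so the
  defect of the average from \<open>1\<close> controls the tail of \<open>M\<close>. The constant \<open>3\<close> is \<open>1 / (1 - 2 / 3)\<close>.
\<close>
lemma tail_le_char_average:
  assumes "real_distribution M"
  shows "measure M {x. 1 \<le> \<bar>s * x\<bar>}
       \<le> 3 * (1 - Re (\<integral>t. char M (s * t) \<partial>std_normal_distribution))"
proof -
  interpret M: real_distribution M by fact
  let ?e = "\<lambda>x. exp (- (s * x)\<^sup>2 / 2)"
  have int: "integrable M ?e"
    by (rule M.integrable_const_bound[where B = 1]) auto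
  have e: "exp (- (1::real) / 2) \<le> 2 / 3"
    using exp_ge_add_one_self[of "1/2::real"] by (simp add: exp_minus field_simps)
  have "measure M {x. 1 \<le> \<bar>s * x\<bar>} = (\<integral>x. indicator {x. 1 \<le> \<bar>s * x\<bar>} x \<partial>M)"
    by simp
  also have "\<dots> \<le> (\<integral>x. 3 * (1 - ?e x) \<partial>M)"
  proof (rule integral_mono)
    show "indicator {x. 1 \<le> \<bar>s * x\<bar>} x \<le> 3 * (1 - ?e x)" for x
    proof (cases "1 \<le> \<bar>s * x\<bar>")
      case True
      then have "1 \<le> (s * x)\<^sup>2" using one_le_power[of "\<bar>s * x\<bar>" 2] by simp
      then have "?e x \<le> exp (- (1::real) / 2)" by simp
      with e have "?e x \<le> 2 / 3" by linarith
      with True show ?thesis by simp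
    qed simp
  qed (use int in \<open>auto simp: M.emeasure_eq_measure\<close>)
  also have "\<dots> = 3 * (1 - (\<integral>x. ?e x \<partial>M))"
    using int by (simp add: M.prob_space[simplified])
  finally show ?thesis by (simp add: integral_char_std_normal[OF assms])
qed

text \<open>
  Continuity of the limit at \<open>0\<close> prevents mass from escaping to infinity. By continuity its Gaussian
  average at a small scale \<open>s\<close> is close to \<open>1\<close>; by dominated convergence the same is true of
  \<open>char (M n)\<close> for all large \<open>n\<close>, which bounds these tails uniformly. The finitely many remaining
  laws are tight one by one.
\<close>
lemma char_limit_imp_tight:
  assumes M: "\<And>n. real_distribution (M n)"
    and lim: "\<And>u. (\<lambda>n. char (M n) u) \<longlonglongrightarrow> \<theta> u"
    and cont: "isCont \<theta> 0"
  shows "tight M"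
proof -
  interpret M: real_distribution "M n" for n by (rule M)
  interpret N: real_distribution std_normal_distribution by (rule real_dist_normal_dist)
  define A where "A n s = (\<integral>t. char (M n) (s * t) \<partial>std_normal_distribution)" for n s
  define L where "L s = (\<integral>t. \<theta> (s * t) \<partial>std_normal_distribution)" for s
  have meas [measurable]: "\<theta> \<in> borel_measurable borel"
    by (rule borel_measurable_LIMSEQ_metric[OF _ lim]) measurable
  have bound: "norm (\<theta> u) \<le> 1" for u
    by (rule tendsto_upperbound[OF tendsto_norm[OF lim]]) (auto simp: M.cmod_char_le_1)
  have "\<theta> 0 = 1"
    using lim[of 0] by (simp add: M.char_zero LIMSEQ_const_iff)
  have A: "(\<lambda>n. A n s) \<longlonglongrightarrow> L s" for s
    unfolding A_def L_def
    by (rule integral_dominated_convergence[where w = "\<lambda>_. 1"])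
       (auto intro: lim simp: M.cmod_char_le_1)
  have L: "(\<lambda>j. L (1 / real (Suc j))) \<longlonglongrightarrow> 1"
  proof -
    have "(\<lambda>j. L (1 / real (Suc j))) \<longlonglongrightarrow> (\<integral>t. 1 \<partial>std_normal_distribution)"
      unfolding L_def
    proof (rule integral_dominated_convergence[where w = "\<lambda>_. 1"])
      have "(\<lambda>j. \<theta> (1 / real (Suc j) * t)) \<longlonglongrightarrow> \<theta> 0" for t
        by (rule isCont_tendsto_compose[OF cont])
           (use tendsto_mult_left_zero[OF LIMSEQ_inverse_real_of_nat] in \<open>simp add: inverse_eq_divide\<close>)
      then show "AE t in std_normal_distribution. (\<lambda>j. \<theta> (1 / real (Suc j) * t)) \<longlonglongrightarrow> 1"
        using \<open>\<theta> 0 = 1\<close> by simp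
    qed (auto simp: bound)
    then show ?thesis by (simp add: N.prob_space[simplified])
  qed
  have "\<exists>a b. a < b \<and> (\<forall>n. 1 - \<epsilon> < measure (M n) {a<..b})" if "0 < \<epsilon>" for \<epsilon> :: real
  proof -
    have "(\<lambda>j. 3 * (1 - Re (L (1 / real (Suc j))))) \<longlonglongrightarrow> 3 * (1 - Re 1)"
      by (intro tendsto_intros L)
    then have "eventually (\<lambda>j. 3 * (1 - Re (L (1 / real (Suc j)))) < \<epsilon>) sequentially"
      using that by (intro order_tendstoD) auto
    then obtain j where j: "3 * (1 - Re (L (1 / real (Suc j)))) < \<epsilon>"
      by (auto simp: eventually_sequentially)
    let ?s = "1 / real (Suc j)"
    have "(\<lambda>n. 3 * (1 - Re (A n ?s))) \<longlonglongrightarrow> 3 * (1 - Re (L ?s))"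
      by (intro tendsto_intros A)
    then have "eventually (\<lambda>n. 3 * (1 - Re (A n ?s)) < \<epsilon>) sequentially"
      using j by (rule order_tendstoD)
    then obtain n0 where n0: "3 * (1 - Re (A n ?s)) < \<epsilon>" if "n \<ge> n0" for n
      by (auto simp: eventually_sequentially)
    have late: "1 - \<epsilon> < measure (M n) {- real k<..real k}" if "n \<ge> n0" "k \<ge> Suc j" for n k
    proof -
      have "measure (M n) {x. 1 \<le> \<bar>?s * x\<bar>} < \<epsilon>"
        using tail_le_char_average[OF M, of n ?s] n0[OF that(1)] by (simp add: A_def)
      moreover have "measure (M n) (UNIV - {x. 1 \<le> \<bar>?s * x\<bar>}) = 1 - measure (M n) {x. 1 \<le> \<bar>?s * x\<bar>}"
        using M.prob_compl[of "{x. 1 \<le> \<bar>?s * x\<bar>}" n] by simp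
      moreover have "measure (M n) (UNIV - {x. 1 \<le> \<bar>?s * x\<bar>}) \<le> measure (M n) {- real k<..real k}"
        using that(2) by (intro M.finite_measure_mono) (auto simp: abs_mult field_simps)
      ultimately show ?thesis by linarith
    qed
    have each: "eventually (\<lambda>k. 1 - \<epsilon> < measure (M n) {- real k<..real k}) sequentially" for n
    proof -
      have UN: "(\<Union>k::nat. {- real k<..real k}) = UNIV"
      proof (intro set_eqI iffI UNIV_I)
        fix x :: real
        obtain k :: nat where "\<bar>x\<bar> < real k" using reals_Archimedean2 by blast
        then show "x \<in> (\<Union>k::nat. {- real k<..real k})" by (intro UN_I[of k]) auto
      qed
      have "(\<lambda>k. measure (M n) {- real k<..real k}) \<longlonglongrightarrow> measure (M n) (\<Union>k::nat. {- real k<..real k})"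
        by (rule M.finite_Lim_measure_incseq) (auto simp: incseq_def)
      then have "(\<lambda>k. measure (M n) {- real k<..real k}) \<longlonglongrightarrow> 1"
        unfolding UN using M.prob_space[of n] by simp
      then show ?thesis using that by (intro order_tendstoD) auto
    qed
    have "eventually (\<lambda>k. \<forall>n\<in>{..<n0}. 1 - \<epsilon> < measure (M n) {- real k<..real k}) sequentially"
      by (intro eventually_ball_finite) (auto intro: each)
    then obtain k0 where k0: "1 - \<epsilon> < measure (M n) {- real k<..real k}" if "n < n0" "k \<ge> k0" for n k
      by (auto simp: eventually_sequentially)
    let ?k = "max k0 (Suc j)"
    have "1 - \<epsilon> < measure (M n) {- real ?k<..real ?k}" for n
      using late[of n ?k] k0[of n ?k] by (cases "n < n0") auto
    then show ?thesis by (intro exI[of _ "- real ?k"] exI[of _ "real ?k"]) auto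
  qed
  then show ?thesis using M by (simp add: tight_def)
qed

text \<open>
  This is the half of Levy's continuity theorem in which the limit law is not given beforehand:
  tightness and Helly's selection theorem produce it.
\<close>
lemma characteristic_function_limit:
  assumes \<phi>: "\<And>n. characteristic_function (\<phi> n)"
    and lim: "\<And>u. (\<lambda>n. \<phi> n u) \<longlonglongrightarrow> \<theta> u"
    and cont: "isCont \<theta> 0"
  shows "characteristic_function \<theta>"
proof -
  obtain M where M: "\<And>n. real_distribution (M n)" "\<And>n. char (M n) = \<phi> n"
    using \<phi> unfolding characteristic_function_def by metis
  have "tight M"
    by (rule char_limit_imp_tight[OF M(1) _ cont]) (simp add: M(2) lim)
  then obtain r L where r: "strict_mono (r :: nat \<Rightarrow> nat)" and L: "real_distribution L"
      and conv: "weak_conv_m (M \<circ> id \<circ> r) L"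
    using tight_imp_convergent_subsubsequence[of M id] by (auto simp: strict_mono_def)
  have "char L u = \<theta> u" for u
  proof (rule LIMSEQ_unique)
    show "(\<lambda>n. char ((M \<circ> id \<circ> r) n) u) \<longlonglongrightarrow> char L u"
      by (rule levy_continuity1[OF _ L conv]) (simp add: M(1))
    show "(\<lambda>n. char ((M \<circ> id \<circ> r) n) u) \<longlonglongrightarrow> \<theta> u"
      using LIMSEQ_subseq_LIMSEQ[OF lim r] by (simp add: M(2) comp_def)
  qed
  with L show ?thesis by (rule characteristic_functionI)
qed

section \<open>Compound Poisson laws\<close>

text \<open>
  Both \<open>1 + z / n\<close> and \<open>exp (z / n)\<close> lie in the unit disc, where taking \<open>n\<close>-th powers enlarges
  distances at most by the factor \<open>n\<close>; the two differ by \<open>O(1 / n\<^sup>2)\<close>.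
\<close>
lemma power_tendsto_exp:
  fixes z :: complex
  assumes "Re z \<le> 0" and unit: "\<And>n. c \<le> real n \<Longrightarrow> 0 < n \<Longrightarrow> norm (1 + z / of_nat n) \<le> 1"
  shows "(\<lambda>n. (1 + z / of_nat n) ^ n) \<longlonglongrightarrow> exp z"
proof -
  let ?w = "\<lambda>n::nat. z / of_nat n"
  let ?b = "\<lambda>n. (exp (norm z) * (norm z)\<^sup>2) / real n"
  have bound: "norm ((1 + ?w n) ^ n - exp z) \<le> ?b n" if n: "c \<le> real n" "0 < n" for n
  proof -
    have w: "norm (?w n) \<le> norm z"
      using n mult_right_mono[of 1 "real n" "norm z"] by (simp add: norm_divide field_simps)
    have "norm (1 + ?w n - exp (?w n)) \<le> exp (norm (?w n)) * norm (?w n) ^ 2"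
      using Taylor_exp_field[of "?w n" 1] by (simp add: norm_minus_commute numeral_2_eq_2)
    also have "\<dots> \<le> exp (norm z) * norm (?w n) ^ 2"
      using w by (intro mult_right_mono) auto
    finally have taylor: "norm (1 + ?w n - exp (?w n)) \<le> exp (norm z) * norm (?w n) ^ 2" .
    have "norm ((1 + ?w n) ^ n - exp z) = norm ((1 + ?w n) ^ n - exp (?w n) ^ n)"
      using n by (simp flip: exp_of_nat_mult)
    also have "\<dots> \<le> real n * norm (1 + ?w n - exp (?w n))"
      using unit[OF n] assms(1) by (intro norm_power_diff) (auto simp: divide_nonpos_nonneg)
    also have "\<dots> \<le> real n * (exp (norm z) * norm (?w n) ^ 2)"
      using taylor by (rule mult_left_mono) simp
    also have "\<dots> = ?b n"
      using n by (simp add: norm_divide power2_eq_square)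
    finally show ?thesis .
  qed
  have "(\<lambda>n. (1 + ?w n) ^ n - exp z) \<longlonglongrightarrow> 0"
  proof (rule Lim_null_comparison)
    show "?b \<longlonglongrightarrow> 0" by (rule lim_const_over_n)
    show "eventually (\<lambda>n. norm ((1 + ?w n) ^ n - exp z) \<le> ?b n) sequentially"
      using eventually_ge_at_top[of "Suc (nat \<lceil>c\<rceil>)"]
      by (rule eventually_mono) (intro bound; linarith)
  qed
  then show ?thesis by (simp add: LIM_zero_iff)
qed

text \<open>
  This is the characteristic function of a Poisson sum, with rate \<open>r\<close>, of independent variables with
  characteristic function \<open>\<phi>\<close>. It is the limit of sums of \<open>n\<close> such variables, each of them kept
  with probability \<open>r / n\<close>.
\<close>
lemma characteristic_function_exp:
  assumes \<phi>: "characteristic_function \<phi>" and "0 \<le> r"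
  shows "characteristic_function (\<lambda>u. exp (of_real r * (\<phi> u - 1)))"
proof (rule characteristic_function_limit)
  \<comment> \<open>The sequence starts beyond \<open>r\<close>, so that \<open>r / m n\<close> is a probability.\<close>
  define m where "m n = Suc (nat \<lceil>r\<rceil>) + n" for n
  have m: "r \<le> real (m n)" "0 < m n" for n unfolding m_def by linarith+
  have lazy: "characteristic_function (\<lambda>u. 1 + of_real r * (\<phi> u - 1) / of_nat k)"
    if "r \<le> real k" "0 < k" for k
    using characteristic_function_lazy[OF \<phi>, of "r / real k"] that assms(2) by simp
  show "characteristic_function (\<lambda>u. (1 + of_real r * (\<phi> u - 1) / of_nat (m n)) ^ m n)" for n
    by (intro characteristic_function_power lazy m)
  show "(\<lambda>n. (1 + of_real r * (\<phi> u - 1) / of_nat (m n)) ^ m n)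
      \<longlonglongrightarrow> exp (of_real r * (\<phi> u - 1))" for u
  proof -
    have "Re (\<phi> u) \<le> 1"
      using complex_Re_le_cmod[of "\<phi> u"] characteristic_function_norm_le_1[OF \<phi>, of u] by linarith
    then have "(\<lambda>n. (1 + of_real r * (\<phi> u - 1) / of_nat n) ^ n) \<longlonglongrightarrow> exp (of_real r * (\<phi> u - 1))"
      using assms(2) by (intro power_tendsto_exp[where c = r] characteristic_function_norm_le_1[OF lazy])
        (auto simp: mult_nonneg_nonpos)
    from LIMSEQ_ignore_initial_segment[OF this, of "Suc (nat \<lceil>r\<rceil>)"] show ?thesis
      by (simp add: m_def add.commute)
  qed
  show "isCont (\<lambda>u. exp (of_real r * (\<phi> u - 1))) 0"
    by (intro continuous_intros characteristic_function_isCont[OF \<phi>])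
qed

text \<open>
  The density \<open>g\<close> of finite total mass \<open>r\<close> is the rate \<open>r\<close> times the probability density \<open>g / r\<close> of
  the jumps.
\<close>
lemma characteristic_function_compound_poisson:
  assumes int: "integrable lborel g" and nonneg: "AE x in lborel. 0 \<le> g x"
  shows "characteristic_function (\<lambda>u. exp (\<integral>x. (iexp (u * x) - 1) * of_real (g x) \<partial>lborel))"
proof (cases "(\<integral>x. g x \<partial>lborel) = 0")
  case True
  have "AE x in lborel. g x = 0"
    using integral_nonneg_eq_0_iff_AE[OF int nonneg] True by simp
  then have "(\<integral>x. (iexp (u * x) - 1) * of_real (g x) \<partial>lborel) = 0" for u
    by (intro integral_eq_zero_AE) auto
  then show ?thesis by (simp add: characteristic_function_one)
next
  case False
  define r where "r = (\<integral>x. g x \<partial>lborel)"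
  have "0 \<le> r" unfolding r_def by (rule integral_nonneg_AE[OF nonneg])
  with False have pos: "0 < r" by (simp add: r_def)
  have [measurable]: "g \<in> borel_measurable borel" using int by auto
  have nonneg': "AE x in lborel. 0 \<le> g x / r" using nonneg pos by auto
  define P where "P = density lborel (\<lambda>x. ennreal (g x / r))"
  have "emeasure P (space P) = (\<integral>\<^sup>+x. ennreal (g x / r) \<partial>lborel)"
    by (simp add: P_def emeasure_density)
  also have "\<dots> = ennreal (\<integral>x. g x / r \<partial>lborel)"
    using int nonneg' by (intro nn_integral_eq_integral) auto
  also have "\<dots> = 1" using pos by (simp add: r_def)
  finally have "prob_space P" by (rule prob_spaceI)
  then have P: "real_distribution P"
    by (simp add: real_distribution_def real_distribution_axioms_def P_def)
  have int_exp: "integrable lborel (\<lambda>x. iexp (u * x) * of_real (g x))" for u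
    by (rule Bochner_Integration.integrable_bound[OF int]) (auto simp: norm_mult simp del: of_real_mult)
  have exponent: "of_real r * (char P u - 1) = (\<integral>x. (iexp (u * x) - 1) * of_real (g x) \<partial>lborel)" for u
  proof -
    have "char P u = (\<integral>x. (g x / r) *\<^sub>R iexp (u * x) \<partial>lborel)"
      unfolding char_def P_def using nonneg' by (intro integral_density) auto
    also have "\<dots> = (\<integral>x. iexp (u * x) * of_real (g x) / of_real r \<partial>lborel)"
      by (simp add: scaleR_conv_of_real mult.commute)
    also have "\<dots> = (\<integral>x. iexp (u * x) * of_real (g x) \<partial>lborel) / of_real r"
      by (rule integral_divide_zero)
    finally have "of_real r * char P u = (\<integral>x. iexp (u * x) * of_real (g x) \<partial>lborel)"
      using pos by simp
    moreover have "(\<integral>x. (iexp (u * x) - 1) * of_real (g x) \<partial>lborel)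
        = (\<integral>x. iexp (u * x) * of_real (g x) \<partial>lborel) - of_real r"
      unfolding left_diff_distrib mult_1 using int_exp[of u] int
      by (subst Bochner_Integration.integral_diff) (auto simp: r_def)
    ultimately show ?thesis by (simp add: right_diff_distrib)
  qed
  have "characteristic_function (char P)" using P by (rule characteristic_functionI) simp
  from characteristic_function_exp[OF this \<open>0 \<le> r\<close>] show ?thesis by (simp only: exponent)
qed

section \<open>Levy exponents give infinitely divisible laws\<close>

definition levy_kernel :: "real \<Rightarrow> real \<Rightarrow> complex" where
  "levy_kernel u x = exp (\<i> * of_real u * of_real x) - 1
     - \<i> * of_real u * of_real x * of_bool (\<bar>x\<bar> \<le> 1)"

lemma levy_exponent_kernel:
  "levy_exponent \<gamma> \<sigma> \<nu> u = \<i> * of_real u * of_real \<gamma> - of_real (\<sigma>\<^sup>2 * u\<^sup>2 / 2)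
     + (\<integral>x. levy_kernel u x * of_real (\<nu> x) \<partial>lborel)"
  by (simp add: levy_exponent_def levy_kernel_def)

lemma levy_kernel_measurable [measurable]: "levy_kernel u \<in> borel_measurable borel"
  unfolding levy_kernel_def[abs_def] by measurable

text \<open>
  The kernel is of second order at \<open>0\<close> because the linear term is subtracted there, and it is bounded
  at infinity because that term is cut off. This is why the integrability in \<^const>\<open>levy_density\<close>
  suffices, and it provides the dominating function in all passages to the limit.
\<close>
lemma norm_levy_kernel_le: "norm (levy_kernel u x) \<le> (2 + u\<^sup>2) * min 1 (x\<^sup>2)"
proof (cases "\<bar>x\<bar> \<le> 1")
  case True
  then have "x\<^sup>2 \<le> 1" by (simp add: abs_square_le_1)
  have "norm (levy_kernel u x) = norm (iexp (u * x) - (\<Sum>k\<le>1. (\<i> * of_real (u * x)) ^ k / fact k))"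
    using True by (simp add: levy_kernel_def algebra_simps)
  also have "\<dots> \<le> \<bar>u * x\<bar> ^ Suc 1 / fact (Suc 1)" by (rule iexp_approx1)
  also have "\<dots> = (u * x)\<^sup>2 / 2" by (simp add: power2_eq_square)
  also have "\<dots> \<le> (2 + u\<^sup>2) * x\<^sup>2" by (simp add: power_mult_distrib algebra_simps)
  finally show ?thesis using \<open>x\<^sup>2 \<le> 1\<close> by simp
next
  case False
  then have "1 \<le> x\<^sup>2" using abs_square_le_1[of x] by simp
  have "norm (levy_kernel u x) \<le> norm (iexp (u * x)) + norm (1::complex)"
    using False norm_triangle_ineq4[of "iexp (u * x)" 1] by (simp add: levy_kernel_def mult_ac)
  also have "\<dots> \<le> (2 + u\<^sup>2) * 1" by (simp del: of_real_mult)
  finally show ?thesis using \<open>1 \<le> x\<^sup>2\<close> by simp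
qed

lemma levy_kernel_integrable:
  assumes "levy_density \<nu>"
  shows "integrable lborel (\<lambda>x. levy_kernel u x * of_real (\<nu> x))"
proof (rule Bochner_Integration.integrable_bound)
  have [measurable]: "\<nu> \<in> borel_measurable borel" using assms by (simp add: levy_density_def)
  show "integrable lborel (\<lambda>x. (2 + u\<^sup>2) * (min 1 (x\<^sup>2) * \<nu> x))"
    using assms by (simp add: levy_density_def)
  show "(\<lambda>x. levy_kernel u x * of_real (\<nu> x)) \<in> borel_measurable lborel" by measurable
  show "AE x in lborel. norm (levy_kernel u x * of_real (\<nu> x)) \<le> norm ((2 + u\<^sup>2) * (min 1 (x\<^sup>2) * \<nu> x))"
    using norm_levy_kernel_le[of u]
    by (auto simp: norm_mult abs_mult mult.assoc[symmetric] intro!: mult_right_mono)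
qed

lemma isCont_levy_exponent:
  assumes \<nu>: "levy_density \<nu>"
  shows "isCont (levy_exponent \<gamma> \<sigma> \<nu>) u"
proof -
  have [measurable]: "\<nu> \<in> borel_measurable borel" using assms by (simp add: levy_density_def)
  have "isCont (\<lambda>u. \<integral>x. levy_kernel u x * of_real (\<nu> x) \<partial>lborel) u"
    unfolding continuous_at_sequentially comp_def
  proof safe
    fix X :: "nat \<Rightarrow> real" assume X: "X \<longlonglongrightarrow> u"
    then obtain B where B: "\<And>n. norm (X n) \<le> B"
      using convergent_imp_Bseq[of X] by (auto simp: convergent_def Bseq_def)
    then have sq: "(X n)\<^sup>2 \<le> B\<^sup>2" for n
      using power_mono[of "\<bar>X n\<bar>" B 2] by simp
    show "(\<lambda>n. \<integral>x. levy_kernel (X n) x * of_real (\<nu> x) \<partial>lborel)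
        \<longlonglongrightarrow> (\<integral>x. levy_kernel u x * of_real (\<nu> x) \<partial>lborel)"
    proof (rule integral_dominated_convergence[where w = "\<lambda>x. \<bar>(2 + B\<^sup>2) * (min 1 (x\<^sup>2) * \<nu> x)\<bar>"])
      show "integrable lborel (\<lambda>x. \<bar>(2 + B\<^sup>2) * (min 1 (x\<^sup>2) * \<nu> x)\<bar>)"
        using \<nu> by (auto simp: levy_density_def)
      show "AE x in lborel. norm (levy_kernel (X n) x * of_real (\<nu> x)) \<le> \<bar>(2 + B\<^sup>2) * (min 1 (x\<^sup>2) * \<nu> x)\<bar>" for n
      proof (intro AE_I2)
        fix x
        have "norm (levy_kernel (X n) x) \<le> (2 + (X n)\<^sup>2) * min 1 (x\<^sup>2)" by (rule norm_levy_kernel_le)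
        also have "\<dots> \<le> (2 + B\<^sup>2) * min 1 (x\<^sup>2)" using sq[of n] by (intro mult_right_mono) auto
        finally show "norm (levy_kernel (X n) x * of_real (\<nu> x)) \<le> \<bar>(2 + B\<^sup>2) * (min 1 (x\<^sup>2) * \<nu> x)\<bar>"
          by (simp add: norm_mult abs_mult mult.assoc[symmetric] mult_right_mono)
      qed
      show "AE x in lborel. (\<lambda>n. levy_kernel (X n) x * of_real (\<nu> x)) \<longlonglongrightarrow> levy_kernel u x * of_real (\<nu> x)"
        unfolding levy_kernel_def by (intro AE_I2 tendsto_intros X)
    qed measurable
  qed
  then show ?thesis
    unfolding levy_exponent_kernel[abs_def] by (intro continuous_intros) auto
qed

text \<open>
  This is the existence half of the Levy--Khinchin theorem, for Levy measures with a density. With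
  the jumps smaller than \<open>1 / (n + 1)\<close> removed, the Levy measure is finite, and the exponent belongs
  to the sum of a Gaussian and an independent compound Poisson variable. Removing the cut-off is a
  pointwise limit by dominated convergence, and the limit is continuous.
\<close>
lemma characteristic_function_levy_exponent:
  assumes \<nu>: "levy_density \<nu>"
  shows "characteristic_function (\<lambda>u. exp (levy_exponent \<gamma> \<sigma> \<nu> u))"
proof (rule characteristic_function_limit)
  have [measurable]: "\<nu> \<in> borel_measurable borel"
    and pos: "AE x in lborel. 0 \<le> \<nu> x"
    and int: "integrable lborel (\<lambda>x. min 1 (x\<^sup>2) * \<nu> x)"
    using \<nu> by (auto simp: levy_density_def)
  define g where "g n x = \<nu> x * of_bool (1 / real (Suc n) \<le> \<bar>x\<bar>)" for n x
  \<comment> \<open>The compensator of the remaining jumps is finite as well and is absorbed into the drift.\<close>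
  define d where "d n = (\<integral>x. x * of_bool (\<bar>x\<bar> \<le> 1) * g n x \<partial>lborel)" for n
  have [measurable]: "g n \<in> borel_measurable borel" for n unfolding g_def[abs_def] by measurable
  have g_le: "\<bar>g n x\<bar> \<le> \<bar>(real (Suc n))\<^sup>2 * (min 1 (x\<^sup>2) * \<nu> x)\<bar>" for n x
  proof (cases "1 / real (Suc n) \<le> \<bar>x\<bar>")
    case True
    then have "1 \<le> real (Suc n) * \<bar>x\<bar>" by (simp add: field_simps)
    then have "1 \<le> (real (Suc n) * \<bar>x\<bar>)\<^sup>2" by (rule one_le_power)
    then have "1 \<le> (real (Suc n))\<^sup>2 * min 1 (x\<^sup>2)"
      by (simp add: power_mult_distrib min_def one_le_power del: of_nat_Suc)
    then have "1 * \<bar>\<nu> x\<bar> \<le> ((real (Suc n))\<^sup>2 * min 1 (x\<^sup>2)) * \<bar>\<nu> x\<bar>" by (rule mult_right_mono) simp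
    with True show ?thesis by (simp add: g_def abs_mult mult.assoc)
  qed (simp add: g_def)
  have g: "integrable lborel (g n)" for n
  proof (rule Bochner_Integration.integrable_bound)
    show "integrable lborel (\<lambda>x. (real (Suc n))\<^sup>2 * (min 1 (x\<^sup>2) * \<nu> x))" using int by simp
  qed (use g_le in \<open>auto simp del: of_nat_Suc\<close>)
  have xg: "integrable lborel (\<lambda>x. x * of_bool (\<bar>x\<bar> \<le> 1) * g n x)" for n
    by (rule Bochner_Integration.integrable_bound[OF g[of n]])
       (auto simp: abs_mult mult_left_le_one_le)
  have eg: "integrable lborel (\<lambda>x. (iexp (u * x) - 1) * of_real (g n x))" for n u
  proof (rule Bochner_Integration.integrable_bound)
    show "integrable lborel (\<lambda>x. 2 * g n x)" using g by simp
    have "norm (iexp (u * x) - 1) \<le> 2" for x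
      using norm_triangle_ineq4[of "iexp (u * x)" 1] by (simp del: of_real_mult)
    then show "AE x in lborel. norm ((iexp (u * x) - 1) * of_real (g n x)) \<le> norm (2 * g n x)"
      by (simp add: norm_mult abs_mult mult_right_mono del: of_real_mult)
  qed measurable
  have kernel: "(\<integral>x. levy_kernel u x * of_real (g n x) \<partial>lborel)
      = (\<integral>x. (iexp (u * x) - 1) * of_real (g n x) \<partial>lborel) - \<i> * of_real u * of_real (d n)" for u n
  proof -
    have "levy_kernel u x * of_real (g n x) = (iexp (u * x) - 1) * of_real (g n x)
        - (\<i> * of_real u) * of_real (x * of_bool (\<bar>x\<bar> \<le> 1) * g n x)" for x
      by (simp add: levy_kernel_def algebra_simps)
    then show ?thesis
      using eg[of u n] xg[of n] by (simp add: d_def del: of_real_mult)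
  qed
  let ?\<phi> = "\<lambda>n u. exp (\<i> * of_real u * of_real (\<gamma> - d n) - of_real (\<sigma>\<^sup>2 * u\<^sup>2 / 2))
      * exp (\<integral>x. (iexp (u * x) - 1) * of_real (g n x) \<partial>lborel)"
  have "AE x in lborel. 0 \<le> g n x" for n using pos by (auto simp: g_def)
  then show "characteristic_function (?\<phi> n)" for n
    by (intro characteristic_function_mult characteristic_function_gaussian
        characteristic_function_compound_poisson g)
  have \<phi>: "?\<phi> n u = exp (levy_exponent \<gamma> \<sigma> (g n) u)" for n u
    unfolding levy_exponent_kernel kernel by (simp add: exp_add[symmetric] algebra_simps)
  show "(\<lambda>n. ?\<phi> n u) \<longlonglongrightarrow> exp (levy_exponent \<gamma> \<sigma> \<nu> u)" for u
    unfolding \<phi> unfolding levy_exponent_kernel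
  proof (intro tendsto_intros integral_dominated_convergence)
    show "integrable lborel (\<lambda>x. norm (levy_kernel u x * of_real (\<nu> x)))"
      using levy_kernel_integrable[OF \<nu>] by (rule integrable_norm)
    show "AE x in lborel. norm (levy_kernel u x * of_real (g n x)) \<le> norm (levy_kernel u x * of_real (\<nu> x))" for n
      by (auto simp: g_def norm_mult)
    show "AE x in lborel. (\<lambda>n. levy_kernel u x * of_real (g n x)) \<longlonglongrightarrow> levy_kernel u x * of_real (\<nu> x)"
    proof (intro AE_I2)
      fix x :: real
      show "(\<lambda>n. levy_kernel u x * of_real (g n x)) \<longlonglongrightarrow> levy_kernel u x * of_real (\<nu> x)"
      proof (cases "x = 0")
        case False
        then have "eventually (\<lambda>n. inverse (real (Suc n)) < \<bar>x\<bar>) sequentially"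
          by (intro order_tendstoD[OF LIMSEQ_inverse_real_of_nat]) auto
        then have "eventually (\<lambda>n. levy_kernel u x * of_real (g n x) = levy_kernel u x * of_real (\<nu> x)) sequentially"
          by (rule eventually_mono) (simp add: g_def inverse_eq_divide)
        then show ?thesis by (rule tendsto_eventually)
      qed (simp add: levy_kernel_def)
    qed
  qed measurable
  show "isCont (\<lambda>u. exp (levy_exponent \<gamma> \<sigma> \<nu> u)) 0"
    by (intro continuous_intros isCont_levy_exponent[OF \<nu>])
qed

text \<open>
  The exponent is linear in \<open>(\<gamma>, \<sigma>\<^sup>2, \<nu>)\<close>, so the \<open>n\<close>-th root has the triplet
  \<open>(\<gamma> / n, \<sigma> / sqrt n, \<nu> / n)\<close>; what needs proof is that a law with this triplet exists.
\<close>
lemma infinitely_divisible_levy_exponent: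
  assumes M: "real_distribution M" and \<nu>: "levy_density \<nu>"
    and char: "\<And>u. char M u = exp (levy_exponent \<gamma> \<sigma> \<nu> u)"
  shows "infinitely_divisible M"
  unfolding infinitely_divisible_def
proof (intro conjI allI impI M)
  fix n :: nat assume n: "1 \<le> n"
  let ?\<nu> = "\<lambda>x. \<nu> x / real n"
  let ?\<psi> = "levy_exponent (\<gamma> / real n) (\<sigma> / sqrt (real n)) ?\<nu>"
  have "levy_density ?\<nu>"
    using \<nu> n by (auto simp: levy_density_def)
  from characteristic_function_levy_exponent[OF this]
  obtain N where N: "real_distribution N" "char N = (\<lambda>u. exp (?\<psi> u))"
    unfolding characteristic_function_def by blast
  have "of_nat n * ?\<psi> u = levy_exponent \<gamma> \<sigma> \<nu> u" for u
    using n by (simp add: levy_exponent_def power_divide field_simps)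
  then have "char M u = char N u ^ n" for u
    by (simp add: char N exp_of_nat_mult[symmetric])
  with N show "\<exists>N. real_distribution N \<and> (\<forall>u. char M u = char N u ^ n)" by blast
qed

section \<open>The triplet of the remainder\<close>

text \<open>
  The exponential and linear terms depend on \<open>u * x\<close> only; the truncation does not scale, which is
  the origin of the drift correction.
\<close>
lemma levy_kernel_scale:
  "levy_kernel u (a * x) = levy_kernel (a * u) x
     - \<i> * of_real (a * u) * of_real (x * (of_bool (\<bar>a * x\<bar> \<le> 1) - of_bool (\<bar>x\<bar> \<le> 1)))"
  by (simp add: levy_kernel_def algebra_simps)

text \<open>
  Substituting \<open>a * x\<close> for \<open>x\<close> turns the integral of \<open>levy_kernel u x\<close> against \<open>\<nu> (x / a) / a\<close> into that
  of \<open>levy_kernel u (a * x)\<close> against \<open>\<nu>\<close>. By the scaling rule for the kernel this is the jump part at \<open>a * u\<close>, up to a linear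
  term supported on \<open>1 < \<bar>x\<bar> \<le> 1 / a\<close>, where \<open>x * \<nu> x\<close> is integrable.
\<close>
lemma levy_exponent_diff_scale:
  assumes \<nu>: "levy_density \<nu>" and a: "0 < a" "a < 1"
  shows "levy_exponent
      (\<gamma> * (1 - a) - a * (\<integral>x. x * (of_bool (\<bar>x\<bar> \<le> 1 / a) - of_bool (\<bar>x\<bar> \<le> 1)) * \<nu> x \<partial>lborel))
      (\<sigma> * sqrt (1 - a\<^sup>2)) (\<lambda>x. \<nu> x - \<nu> (x / a) / a) u
    = levy_exponent \<gamma> \<sigma> \<nu> u - levy_exponent \<gamma> \<sigma> \<nu> (a * u)"
proof -
  have [measurable]: "\<nu> \<in> borel_measurable borel" using \<nu> by (simp add: levy_density_def)
  let ?s = "\<lambda>x. x * (of_bool (\<bar>x\<bar> \<le> 1 / a) - of_bool (\<bar>x\<bar> \<le> 1)) * \<nu> x"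
  let ?K = "\<lambda>u x. levy_kernel u x * of_real (\<nu> x)"
  have s: "integrable lborel ?s"
  proof (rule Bochner_Integration.integrable_bound)
    show "integrable lborel (\<lambda>x. 1 / a * (min 1 (x\<^sup>2) * \<nu> x))"
      using \<nu> by (simp add: levy_density_def)
    show "?s \<in> borel_measurable lborel" by measurable
    show "AE x in lborel. norm (?s x) \<le> norm (1 / a * (min 1 (x\<^sup>2) * \<nu> x))"
    proof (intro AE_I2)
      fix x
      have le: "\<bar>x * (of_bool (\<bar>x\<bar> \<le> 1 / a) - of_bool (\<bar>x\<bar> \<le> 1))\<bar> \<le> 1 / a * min 1 (x\<^sup>2)"
      proof (cases "1 < \<bar>x\<bar> \<and> \<bar>x\<bar> \<le> 1 / a")
        case True
        then have "1 \<le> x\<^sup>2" using abs_square_le_1[of x] by simp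
        with True show ?thesis by simp
      next
        case False
        moreover have "1 < 1 / a" using a by simp
        ultimately have "of_bool (\<bar>x\<bar> \<le> 1 / a) - of_bool (\<bar>x\<bar> \<le> 1) = (0::real)" by auto
        then show ?thesis using a by simp
      qed
      have "norm (?s x) = \<bar>x * (of_bool (\<bar>x\<bar> \<le> 1 / a) - of_bool (\<bar>x\<bar> \<le> 1))\<bar> * \<bar>\<nu> x\<bar>"
        by (simp only: real_norm_def abs_mult)
      also have "\<dots> \<le> (1 / a * min 1 (x\<^sup>2)) * \<bar>\<nu> x\<bar>"
        using le by (rule mult_right_mono) simp
      also have "\<dots> = norm (1 / a * (min 1 (x\<^sup>2) * \<nu> x))"
        using a by (simp add: abs_mult)
      finally show "norm (?s x) \<le> norm (1 / a * (min 1 (x\<^sup>2) * \<nu> x))" .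
    qed
  qed
  have scaled: "levy_kernel u (a * x) * of_real (\<nu> x)
      = ?K (a * u) x - \<i> * of_real (a * u) * of_real (?s x)" for x
  proof -
    have "\<bar>a * x\<bar> \<le> 1 \<longleftrightarrow> \<bar>x\<bar> \<le> 1 / a" using a by (simp add: abs_mult field_simps)
    then have "of_bool (\<bar>a * x\<bar> \<le> 1) = (of_bool (\<bar>x\<bar> \<le> 1 / a) :: real)" by simp
    then show ?thesis by (simp add: levy_kernel_scale algebra_simps)
  qed
  have int': "integrable lborel (\<lambda>x. levy_kernel u (a * x) * of_real (\<nu> x))"
    unfolding scaled using s levy_kernel_integrable[OF \<nu>]
    by (intro Bochner_Integration.integrable_diff integrable_mult_right integrable_of_real) auto
  \<comment> \<open>The jump part that the remainder loses; its integrability is transported by the substitution.\<close>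
  let ?f = "\<lambda>x. levy_kernel u x * of_real (\<nu> (x / a) / a)"
  have fa: "?f (0 + a * x) = levy_kernel u (a * x) * of_real (\<nu> x) / of_real a" for x
    using a by simp
  have f: "integrable lborel ?f"
    using lborel_integrable_real_affine_iff[of a ?f 0] int' a unfolding fa by simp
  have "(\<integral>x. ?f x \<partial>lborel) = \<bar>a\<bar> *\<^sub>R (\<integral>x. ?f (0 + a * x) \<partial>lborel)"
    using a by (intro lborel_integral_real_affine) simp
  also have "\<dots> = (\<integral>x. levy_kernel u (a * x) * of_real (\<nu> x) \<partial>lborel)"
    unfolding fa using a by (simp add: scaleR_conv_of_real)
  also have "\<dots> = (\<integral>x. ?K (a * u) x \<partial>lborel) - \<i> * of_real (a * u) * of_real (\<integral>x. ?s x \<partial>lborel)"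
    unfolding scaled using s levy_kernel_integrable[OF \<nu>]
    by (subst Bochner_Integration.integral_diff)
       (auto simp del: of_real_mult of_real_diff intro!: integrable_mult_right integrable_of_real)
  finally have If: "(\<integral>x. ?f x \<partial>lborel)
    = (\<integral>x. ?K (a * u) x \<partial>lborel) - \<i> * of_real (a * u) * of_real (\<integral>x. ?s x \<partial>lborel)" .
  have "(\<integral>x. levy_kernel u x * of_real (\<nu> x - \<nu> (x / a) / a) \<partial>lborel)
      = (\<integral>x. ?K u x - ?f x \<partial>lborel)"
    by (simp add: algebra_simps)
  also have "\<dots> = (\<integral>x. ?K u x \<partial>lborel) - (\<integral>x. ?f x \<partial>lborel)"
    using f levy_kernel_integrable[OF \<nu>] by (intro Bochner_Integration.integral_diff)
  finally have jump: "(\<integral>x. levy_kernel u x * of_real (\<nu> x - \<nu> (x / a) / a) \<partial>lborel)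
    = (\<integral>x. ?K u x \<partial>lborel) - (\<integral>x. ?K (a * u) x \<partial>lborel)
      + \<i> * of_real (a * u) * of_real (\<integral>x. ?s x \<partial>lborel)"
    unfolding If by (simp only: diff_diff_eq2 add.commute diff_add_eq)
  have "a\<^sup>2 \<le> 1" using a by (simp add: power_le_one)
  then have gauss: "(\<sigma> * sqrt (1 - a\<^sup>2))\<^sup>2 * u\<^sup>2 / 2 = \<sigma>\<^sup>2 * u\<^sup>2 / 2 - \<sigma>\<^sup>2 * (a * u)\<^sup>2 / 2"
    by (simp add: power_mult_distrib algebra_simps diff_divide_distrib)
  show ?thesis
    unfolding levy_exponent_kernel jump gauss by (simp add: algebra_simps)
qed

text \<open>
  Monotonicity of \<open>k\<close> on each half-line is what makes the difference nonnegative: \<open>x / a\<close> lies on the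
  same side of \<open>0\<close> as \<open>x\<close> and farther out. Since \<open>k\<close> is nonnegative, the difference is also at most
  \<open>\<nu>\<close>, whence the integrability.
\<close>
lemma levy_density_remainder:
  assumes \<nu>: "levy_density \<nu>" and k: "\<And>x. x \<noteq> 0 \<Longrightarrow> \<nu> x = k x / \<bar>x\<bar>"
    and nonneg: "\<And>x. x \<noteq> 0 \<Longrightarrow> 0 \<le> k x"
    and mono: "mono_on {..<0} k" and anti: "antimono_on {0<..} k"
    and a: "0 < a" "a < 1"
  shows "levy_density (\<lambda>x. (k x - k (x / a)) / \<bar>x\<bar>)"
proof -
  let ?\<nu>a = "\<lambda>x. (k x - k (x / a)) / \<bar>x\<bar>"
  have [measurable]: "\<nu> \<in> borel_measurable borel" using \<nu> by (simp add: levy_density_def)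
  \<comment> \<open>At \<open>0\<close> the division by zero gives \<open>0\<close>, whatever the values of \<open>k\<close> and \<open>\<nu>\<close> there.\<close>
  have "?\<nu>a = (\<lambda>x. if x = 0 then 0 else \<nu> x - \<nu> (x / a) / a)"
    using a by (auto simp: fun_eq_iff k field_simps abs_mult)
  then have meas [measurable]: "?\<nu>a \<in> borel_measurable borel"
    by simp
  have le: "0 \<le> ?\<nu>a x" "x \<noteq> 0 \<Longrightarrow> ?\<nu>a x \<le> \<nu> x" for x
  proof -
    have "k (x / a) \<le> k x"
    proof (cases x "0 :: real" rule: linorder_cases)
      case less
      then have "x / a \<le> x" "x / a < 0" using a by (auto simp: field_simps mult_le_cancel_left)
      then show ?thesis using mono less by (auto simp: monotone_on_def)
    next
      case greater
      then have "x \<le> x / a" "0 < x / a" using a by (auto simp: field_simps)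
      then show ?thesis using anti greater by (auto simp: monotone_on_def)
    qed simp
    then show "0 \<le> ?\<nu>a x" by simp
    show "?\<nu>a x \<le> \<nu> x" if "x \<noteq> 0"
      using that a nonneg[of "x / a"] by (simp add: k divide_right_mono)
  qed
  have "integrable lborel (\<lambda>x. min 1 (x\<^sup>2) * ?\<nu>a x)"
  proof (rule Bochner_Integration.integrable_bound)
    show "integrable lborel (\<lambda>x. min 1 (x\<^sup>2) * \<nu> x)" using \<nu> by (simp add: levy_density_def)
    show "(\<lambda>x. min 1 (x\<^sup>2) * ?\<nu>a x) \<in> borel_measurable lborel"
      using meas by measurable
    have "norm (min 1 (x\<^sup>2) * ?\<nu>a x) \<le> norm (min 1 (x\<^sup>2) * \<nu> x)" for x
    proof (cases "x = 0")
      case False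
      have "\<bar>?\<nu>a x\<bar> \<le> \<bar>\<nu> x\<bar>" using le(1)[of x] le(2)[OF False] by linarith
      then show ?thesis unfolding real_norm_def abs_mult by (rule mult_left_mono) simp
    qed simp
    then show "AE x in lborel. norm (min 1 (x\<^sup>2) * ?\<nu>a x) \<le> norm (min 1 (x\<^sup>2) * \<nu> x)" by simp
  qed
  with meas le(1) show ?thesis by (simp add: levy_density_def)
qed

lemma levy_exponent_cong_AE:
  assumes [measurable]: "\<mu> \<in> borel_measurable borel" "\<nu> \<in> borel_measurable borel"
    and "AE x in lborel. \<mu> x = \<nu> x"
  shows "levy_exponent \<gamma> \<sigma> \<mu> = levy_exponent \<gamma> \<sigma> \<nu>"
proof
  fix u
  have "(\<integral>x. levy_kernel u x * of_real (\<mu> x) \<partial>lborel) = (\<integral>x. levy_kernel u x * of_real (\<nu> x) \<partial>lborel)"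
    using assms(3) by (intro integral_cong_AE) auto
  then show "levy_exponent \<gamma> \<sigma> \<mu> u = levy_exponent \<gamma> \<sigma> \<nu> u"
    by (simp add: levy_exponent_kernel)
qed

theorem proposition3p1:
  fixes M R :: "real measure" and \<gamma> \<sigma> a :: real and \<nu> k :: "real \<Rightarrow> real"
  assumes "self_decomposable M"
    and "has_levy_triplet M \<gamma> \<sigma> \<nu>"
    and "\<And>x. x \<noteq> 0 \<Longrightarrow> \<nu> x = k x / \<bar>x\<bar>"
    and "\<And>x. x \<noteq> 0 \<Longrightarrow> 0 \<le> k x"
    and "mono_on {..<0} k"
    and "antimono_on {0<..} k"
    and "0 < a" and "a < 1"
    and "remainder_law a M R"
  shows "has_levy_triplet R
           (\<gamma> * (1 - a) - a * (\<integral>x. sgn x * (of_bool (\<bar>x\<bar> \<le> 1 / a) - of_bool (\<bar>x\<bar> \<le> 1)) * k x \<partial>lborel))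
           (\<sigma> * sqrt (1 - a\<^sup>2))
           (\<lambda>x. (k x - k (x / a)) / \<bar>x\<bar>)
         \<and> (\<forall>x. x \<noteq> 0 \<longrightarrow> (k x - k (x / a)) / \<bar>x\<bar> = \<nu> x - \<nu> (x / a) / a)"
proof -
  let ?\<gamma>a = "\<gamma> * (1 - a) - a * (\<integral>x. sgn x * (of_bool (\<bar>x\<bar> \<le> 1 / a) - of_bool (\<bar>x\<bar> \<le> 1)) * k x \<partial>lborel)"
  let ?\<sigma>a = "\<sigma> * sqrt (1 - a\<^sup>2)"
  let ?\<nu>a = "\<lambda>x. (k x - k (x / a)) / \<bar>x\<bar>"
  let ?\<nu>d = "\<lambda>x. \<nu> x - \<nu> (x / a) / a"
  have \<nu>: "levy_density \<nu>" and "0 \<le> \<sigma>" and M: "\<And>u. char M u = exp (levy_exponent \<gamma> \<sigma> \<nu> u)"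
    using assms(2) by (auto simp: has_levy_triplet_def)
  have R: "real_distribution R" and MR: "\<And>u. char M u = char M (a * u) * char R u"
    using assms(9) unfolding remainder_law_def by blast+
  have [measurable]: "\<nu> \<in> borel_measurable borel" using \<nu> by (simp add: levy_density_def)
  have density: "?\<nu>a x = ?\<nu>d x" if "x \<noteq> 0" for x
    using that assms(7) assms(3)[of x] assms(3)[of "x / a"] by (simp add: diff_divide_distrib)
  have AE: "AE x in lborel. ?\<nu>a x = ?\<nu>d x"
    using AE_lborel_singleton[of "0::real"] by eventually_elim (rule density)
  have \<nu>a: "levy_density ?\<nu>a"
    by (rule levy_density_remainder[OF \<nu> assms(3-8)])
  have drift: "(\<integral>x. sgn x * (of_bool (\<bar>x\<bar> \<le> 1 / a) - of_bool (\<bar>x\<bar> \<le> 1)) * k x \<partial>lborel)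
      = (\<integral>x. x * (of_bool (\<bar>x\<bar> \<le> 1 / a) - of_bool (\<bar>x\<bar> \<le> 1)) * \<nu> x \<partial>lborel)"
  proof (intro Bochner_Integration.integral_cong refl)
    fix x :: real
    show "sgn x * (of_bool (\<bar>x\<bar> \<le> 1 / a) - of_bool (\<bar>x\<bar> \<le> 1)) * k x
        = x * (of_bool (\<bar>x\<bar> \<le> 1 / a) - of_bool (\<bar>x\<bar> \<le> 1)) * \<nu> x"
      by (cases "x = 0") (auto simp: assms(3) sgn_real_def)
  qed
  have "levy_exponent ?\<gamma>a ?\<sigma>a ?\<nu>a u = levy_exponent \<gamma> \<sigma> \<nu> u - levy_exponent \<gamma> \<sigma> \<nu> (a * u)" for u
  proof -
    have "levy_exponent ?\<gamma>a ?\<sigma>a ?\<nu>a = levy_exponent ?\<gamma>a ?\<sigma>a ?\<nu>d"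
      using \<nu>a by (intro levy_exponent_cong_AE[OF _ _ AE]) (auto simp only: levy_density_def, measurable)
    then show ?thesis
      by (simp only: drift levy_exponent_diff_scale[OF \<nu> assms(7,8)])
  qed
  moreover have "char R u = exp (levy_exponent \<gamma> \<sigma> \<nu> u - levy_exponent \<gamma> \<sigma> \<nu> (a * u))" for u
    using MR[of u] by (simp add: M exp_diff field_simps)
  ultimately have char: "char R u = exp (levy_exponent ?\<gamma>a ?\<sigma>a ?\<nu>a u)" for u
    by simp
  have "0 \<le> ?\<sigma>a" using \<open>0 \<le> \<sigma>\<close> assms(7,8) by (simp add: power_le_one)
  with char \<nu>a infinitely_divisible_levy_exponent[OF R \<nu>a char] density show ?thesis
    by (auto simp: has_levy_triplet_def)
qed

end
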